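(* Let $G$ be a discrete infinite amenable group acting on a compact metric space $(X,d)$ (a $G$-system), let $\mathcal{F}=\{F_n\}_{n\in D}$ be any F{\o}lner net in $G$, and let $x\in X$. Then the minimal $\mathcal{F}$-center of attraction $\mathcal{C}_{\mathcal{F}}(x)$ of $x$ satisfies $$\mathcal{C}_{\mathcal{F}}(x)=\left\{y\in X \mid \overline{d}_{\mathcal{F}}(\{g\in G\mid gx\in U\})>0\ \text{ for every neighborhood } U \text{ of } y\right\}.$$ Consequently, a minimal $\mathcal{F}$-center of attraction of $x$ always exists, for every $x\in X$ and every F{\o}lner net $\mathcal{F}$ in $G$.
   Context: A $G$-system $(G,X)$: $G$ is a discrete infinite amenable group with identity $e$, $(X,d)$ is a compact metric space, and $G$ acts on $X$ from the left by continuous transformations ($ex=x$, $(gf)x=g(fx)$). A (left) F{\o}lner net in $G$ is a net $\mathcal{F}=\{F_n\}_{n\in D}$ ($D$ a directed set) of (nonempty) finite subsets of $G$ with $\lim_{n\in D}|gF_n\vartriangle F_n|/|F_n|=0$ for all $g\in G$. For $A\subseteq G$, the upper density is $\overline{d}_{\mathcal{F}}(A)=\sup\{\alpha \mid \forall m\in D\ \exists n\ge m:\ |A\cap F_n|/|F_n|\ge\alpha\}$, and the lower density is $\underline{d}_{\mathcal{F}}(A)=\sup\{\alpha \mid \exists m\in D\ \forall n\ge m:\ |A\cap F_n|/|F_n|\ge\alpha\}$. If they coincide, the common value is the density $d_{\mathcal{F}}(A)$. A closed set $C\subseteq X$ is an $\mathcal{F}$-center of attraction of $x$ if for every $\epsilon>0$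 the density $d_{\mathcal{F}}(\{g\in G\mid gx\in B_\epsilon(C)\})$ exists and equals $1$, where $B_\epsilon(C)$ is the $\epsilon$-neighborhood of $C$. If moreover no proper subset of $C$ is an $\mathcal{F}$-center of attraction of $x$, then $C$ is called the minimal $\mathcal{F}$-center of attraction of $x$, denoted $\mathcal{C}_{\mathcal{F}}(x)$. *)

theory Defs
  imports "HOL-Algebra.Group_Action" "HOL-Analysis.Abstract_Metric_Spaces"
begin

text \<open>Amenability of a discrete group in the sense of von Neumann: there is a left-invariant,
  finitely additive probability measure on all subsets of the group.\<close>

definition amenable :: "('g, 'm) monoid_scheme \<Rightarrow> bool" where
  "amenable G \<longleftrightarrow> (\<exists>\<mu> :: 'g set \<Rightarrow> real.
     (\<forall>A \<subseteq> carrier G. \<mu> A \<ge> 0) \<and>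
     \<mu> (carrier G) = 1 \<and>
     (\<forall>A B. A \<subseteq> carrier G \<and> B \<subseteq> carrier G \<and> A \<inter> B = {} \<longrightarrow> \<mu> (A \<union> B) = \<mu> A + \<mu> B) \<and>
     (\<forall>g \<in> carrier G. \<forall>A \<subseteq> carrier G. \<mu> (g <#\<^bsub>G\<^esub> A) = \<mu> A))"

text \<open>The order of a directed set \<open>D\<close> is a preorder \<open>r\<close>, with \<open>(m, n) \<in> r\<close> read as \<open>m \<le> n\<close>.\<close>

definition directed_set :: "'i set \<Rightarrow> ('i \<times> 'i) set \<Rightarrow> bool" where
  "directed_set D r \<longleftrightarrow> D \<noteq> {} \<and> preorder_on D r \<and>
     (\<forall>a \<in> D. \<forall>b \<in> D. \<exists>c \<in> D. (a, c) \<in> r \<and> (b, c) \<in> r)"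

definition net_filter :: "'i set \<Rightarrow> ('i \<times> 'i) set \<Rightarrow> 'i filter" where
  "net_filter D r = (INF m \<in> D. principal {n \<in> D. (m, n) \<in> r})"

lemma eventually_net_filter:
  assumes "directed_set D r"
  shows "eventually P (net_filter D r) \<longleftrightarrow> (\<exists>m \<in> D. \<forall>n \<in> D. (m, n) \<in> r \<longrightarrow> P n)"
proof -
  have "eventually P (net_filter D r) \<longleftrightarrow>
      (\<exists>m \<in> D. eventually P (principal {n \<in> D. (m, n) \<in> r}))"
    unfolding net_filter_def
  proof (rule eventually_INF_base)
    show "D \<noteq> {}"
      using assms by (simp add: directed_set_def)
    fix a b assume "a \<in> D" "b \<in> D"
    then obtain c where c: "c \<in> D" "(a, c) \<in> r" "(b, c) \<in> r"
      using assms by (auto simp: directed_set_def)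
    have "trans r"
      using assms by (simp add: directed_set_def preorder_on_def)
    then have "principal {n \<in> D. (c, n) \<in> r}
        \<le> inf (principal {n \<in> D. (a, n) \<in> r}) (principal {n \<in> D. (b, n) \<in> r})"
      using c by (auto dest: transD)
    then show "\<exists>x \<in> D. principal {n \<in> D. (x, n) \<in> r}
        \<le> inf (principal {n \<in> D. (a, n) \<in> r}) (principal {n \<in> D. (b, n) \<in> r})"
      using c(1) by blast
  qed
  then show ?thesis
    by (auto simp: eventually_principal)
qed

definition folner_net ::
    "('g, 'm) monoid_scheme \<Rightarrow> 'i set \<Rightarrow> ('i \<times> 'i) set \<Rightarrow> ('i \<Rightarrow> 'g set) \<Rightarrow> bool" where
  "folner_net G D r F \<longleftrightarrow> directed_set D r \<and>
     (\<forall>n \<in> D. F n \<noteq> {} \<and> finite (F n) \<and> F n \<subseteq> carrier G) \<and>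
     (\<forall>g \<in> carrier G.
        ((\<lambda>n. real (card (sym_diff (g <#\<^bsub>G\<^esub> F n) (F n))) / real (card (F n))) \<longlongrightarrow> 0)
          (net_filter D r))"

definition upper_density ::
    "'i set \<Rightarrow> ('i \<times> 'i) set \<Rightarrow> ('i \<Rightarrow> 'g set) \<Rightarrow> 'g set \<Rightarrow> real" where
  "upper_density D r F A =
     Sup {\<alpha>. \<forall>m \<in> D. \<exists>n \<in> D. (m, n) \<in> r \<and> real (card (A \<inter> F n)) / real (card (F n)) \<ge> \<alpha>}"

definition lower_density ::
    "'i set \<Rightarrow> ('i \<times> 'i) set \<Rightarrow> ('i \<Rightarrow> 'g set) \<Rightarrow> 'g set \<Rightarrow> real" where
  "lower_density D r F A =
     Sup {\<alpha>. \<exists>m \<in> D. \<forall>n \<in> D. (m, n) \<in> r \<longrightarrow> real (card (A \<inter> F n)) / real (card (F n)) \<ge> \<alpha>}"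

definition has_density ::
    "'i set \<Rightarrow> ('i \<times> 'i) set \<Rightarrow> ('i \<Rightarrow> 'g set) \<Rightarrow> 'g set \<Rightarrow> real \<Rightarrow> bool" where
  "has_density D r F A \<delta> \<longleftrightarrow> upper_density D r F A = \<delta> \<and> lower_density D r F A = \<delta>"

text \<open>The action is \<open>\<phi> :: 'g \<Rightarrow> 'x \<Rightarrow> 'x\<close>, i.e. \<open>\<phi> g x\<close> stands for \<open>gx\<close>. As \<open>\<phi>\<close> is a homomorphism
  into \<open>BijGroup X\<close>, each \<open>\<phi> g\<close> is \<open>undefined\<close> outside \<open>X\<close>.\<close>

locale G_system = group_action G X \<phi> + Metric_space X d
  for G :: "('g, 'm) monoid_scheme" (structure)
    and X :: "'x set" and d :: "'x \<Rightarrow> 'x \<Rightarrow> real" and \<phi> :: "'g \<Rightarrow> 'x \<Rightarrow> 'x" +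
  assumes infinite_group: "infinite (carrier G)"
    and amenable_group: "amenable G"
    and compact_phase_space: "compact_space mtopology"
    and continuous_action: "g \<in> carrier G \<Longrightarrow> continuous_map mtopology mtopology (\<phi> g)"
begin

definition nbhd :: "real \<Rightarrow> 'x set \<Rightarrow> 'x set" where
  "nbhd \<epsilon> C = (\<Union>c \<in> C. mball c \<epsilon>)"

definition center_of_attraction ::
    "'i set \<Rightarrow> ('i \<times> 'i) set \<Rightarrow> ('i \<Rightarrow> 'g set) \<Rightarrow> 'x \<Rightarrow> 'x set \<Rightarrow> bool" where
  "center_of_attraction D r F x C \<longleftrightarrow> closedin mtopology C \<and>
     (\<forall>\<epsilon>>0. has_density D r F {g \<in> carrier G. \<phi> g x \<in> nbhd \<epsilon> C} 1)"

definition minimal_center_of_attraction ::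
    "'i set \<Rightarrow> ('i \<times> 'i) set \<Rightarrow> ('i \<Rightarrow> 'g set) \<Rightarrow> 'x \<Rightarrow> 'x set \<Rightarrow> bool" where
  "minimal_center_of_attraction D r F x C \<longleftrightarrow> center_of_attraction D r F x C \<and>
     (\<forall>C'. C' \<subset> C \<longrightarrow> \<not> center_of_attraction D r F x C')"

end

end

theory Submission
  imports Defs
begin

text \<open>Every center of attraction contains the set \<open>Y\<close> of points all of whose neighborhoods are
  visited with positive upper density, because a point off a closed set \<open>C\<close> has a neighborhood
  disjoint from some \<open>nbhd \<epsilon> C\<close>. Conversely \<open>Y\<close> is itself a center: the complement of
  \<open>nbhd \<epsilon> Y\<close> is compact and covered by open sets visited with density zero, and finitely many
  of them suffice. So \<open>Y\<close> is the least center of attraction.\<close>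

section \<open>Relative frequencies in the sets of the net\<close>

definition freq :: "('i \<Rightarrow> 'g set) \<Rightarrow> 'g set \<Rightarrow> 'i \<Rightarrow> real" where
  "freq F A n = real (card (A \<inter> F n)) / real (card (F n))"

text \<open>An infinite \<open>F n\<close> has cardinality 0 and hence frequency 0, so the bounds need no finiteness.\<close>

lemma freq_nonneg: "0 \<le> freq F A n"
  by (simp add: freq_def)

lemma freq_le_1: "freq F A n \<le> 1"
proof (cases "finite (F n)")
  case True
  then have "card (A \<inter> F n) \<le> card (F n)"
    by (simp add: card_mono)
  then show ?thesis
    by (auto simp: freq_def divide_le_eq_1)
qed (simp add: freq_def)

lemma freq_mono:
  assumes "A \<inter> F n \<subseteq> B"
  shows "freq F A n \<le> freq F B n"
proof (cases "finite (F n)")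
  case True
  then have "card (A \<inter> F n) \<le> card (B \<inter> F n)"
    using assms by (intro card_mono) auto
  then show ?thesis
    by (simp add: freq_def divide_right_mono)
qed (simp add: freq_def)

lemma freq_Un_le: "freq F (A \<union> B) n \<le> freq F A n + freq F B n"
proof -
  have "card ((A \<union> B) \<inter> F n) \<le> card (A \<inter> F n) + card (B \<inter> F n)"
    by (simp add: Int_Un_distrib2 card_Un_le)
  then show ?thesis
    by (simp add: freq_def add_divide_distrib[symmetric] divide_right_mono flip: of_nat_add)
qed

text \<open>If \<open>F n\<close> were empty or infinite, every frequency would be 0 by the
  conventions for \<open>card\<close> and division, and the identity would read 0 = 1; hence the
  first two hypotheses.\<close>

lemma freq_Diff:
  assumes "finite (F n)" "F n \<noteq> {}" "F n \<subseteq> S"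
  shows "freq F (S - A) n = 1 - freq F A n"
proof -
  have "card (F n) = card (F n - A) + card (A \<inter> F n)"
    using card_Diff_subset_Int[of "F n" A] card_mono[of "F n" "A \<inter> F n"] assms(1)
    by (simp add: Int_commute)
  moreover have "(S - A) \<inter> F n = F n - A"
    using assms(3) by auto
  moreover have "card (F n) > 0"
    using assms by (simp add: card_gt_0_iff)
  ultimately show ?thesis
    by (simp add: freq_def field_simps flip: of_nat_add)
qed

text \<open>Together with \<open>freq_tendsto_0_UN\<close>, this makes the sets whose frequency
  tends to 0 an ideal: closed under subsets and finite unions. The compactness argument rests on
  this.\<close>

lemma freq_tendsto_0_mono:
  assumes "(freq F B \<longlongrightarrow> 0) \<F>" "A \<subseteq> B"
  shows "(freq F A \<longlongrightarrow> 0) \<F>"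
proof (rule tendsto_sandwich[OF _ _ tendsto_const assms(1)])
  show "\<forall>\<^sub>F n in \<F>. freq F A n \<le> freq F B n"
    using assms(2) by (intro always_eventually allI freq_mono) auto
qed (simp add: freq_nonneg)

lemma freq_tendsto_0_UN:
  assumes "finite I" "\<And>i. i \<in> I \<Longrightarrow> (freq F (A i) \<longlongrightarrow> 0) \<F>"
  shows "(freq F (\<Union>i\<in>I. A i) \<longlongrightarrow> 0) \<F>"
  using assms
proof (induction I rule: finite_induct)
  case empty
  show ?case by (simp add: freq_def[abs_def])
next
  case (insert i I)
  then have lim: "((\<lambda>n. freq F (A i) n + freq F (\<Union>i\<in>I. A i) n) \<longlongrightarrow> 0) \<F>"
    by (intro tendsto_add_zero) auto
  show ?case
  proof (rule tendsto_sandwich[OF _ _ tendsto_const lim])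
    show "\<forall>\<^sub>F n in \<F>. freq F (\<Union>i\<in>insert i I. A i) n
        \<le> freq F (A i) n + freq F (\<Union>i\<in>I. A i) n"
      by (intro always_eventually allI) (simp add: freq_Un_le)
  qed (simp add: freq_nonneg)
qed

section \<open>Densities expressed as limits of frequencies\<close>

lemma frequently_le_freq_le_1:
  assumes "D \<noteq> {}" "\<forall>m\<in>D. \<exists>n\<in>D. (m, n) \<in> r \<and> \<alpha> \<le> freq F A n"
  shows "\<alpha> \<le> 1"
  using assms freq_le_1[of F A] by (blast intro: order_trans)

text \<open>The supremum is positive iff some positive \<alpha> is reached beyond every index. This
  negates "eventually below \<alpha>, for all positive \<alpha>", which is convergence to 0 for a
  nonnegative function.\<close>

lemma upper_density_pos_iff:
  assumes D: "directed_set D r"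
  shows "upper_density D r F A > 0 \<longleftrightarrow> \<not> (freq F A \<longlongrightarrow> 0) (net_filter D r)"
proof -
  let ?S = "{\<alpha>. \<forall>m\<in>D. \<exists>n\<in>D. (m, n) \<in> r \<and> \<alpha> \<le> freq F A n}"
  have ud: "upper_density D r F A = Sup ?S"
    by (simp add: upper_density_def freq_def)
  have ne: "D \<noteq> {}"
    using D by (simp add: directed_set_def)
  \<comment> \<open>\<open>Sup\<close> on the reals can be used only for a nonempty set that is
    bounded above: 1 is a bound and 0 is a member, since frequencies lie between 0 and 1.\<close>
  have bdd: "bdd_above ?S"
    using frequently_le_freq_le_1[OF ne, of r _ F A] by (intro bdd_aboveI[of _ 1]) auto
  have "0 \<in> ?S"
    using D freq_nonneg[of F A] by (auto simp: directed_set_def)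
  then have "Sup ?S > 0 \<longleftrightarrow> (\<exists>\<alpha>\<in>?S. 0 < \<alpha>)"
    using bdd by (intro less_cSup_iff) auto
  also have "\<dots> \<longleftrightarrow> (\<exists>\<alpha>>0. \<not> (\<forall>\<^sub>F n in net_filter D r. freq F A n < \<alpha>))"
    by (force simp: eventually_net_filter[OF D] not_less)
  also have "\<dots> \<longleftrightarrow> \<not> (freq F A \<longlongrightarrow> 0) (net_filter D r)"
    by (simp add: tendsto_iff dist_real_def freq_nonneg)
  finally show ?thesis
    by (simp add: ud)
qed

text \<open>Lower density is at most upper density, which is at most 1, so only the bound 1 \<le>
  lower density has content. Likewise the upper half of the limit is automatic, as frequencies never
  exceed 1.\<close>

lemma has_density_1_iff:
  assumes D: "directed_set D r"
  shows "has_density D r F A 1 \<longleftrightarrow> (freq F A \<longlongrightarrow> 1) (net_filter D r)"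
proof -
  let ?U = "{\<alpha>. \<forall>m\<in>D. \<exists>n\<in>D. (m, n) \<in> r \<and> \<alpha> \<le> freq F A n}"
  let ?L = "{\<alpha>. \<exists>m\<in>D. \<forall>n\<in>D. (m, n) \<in> r \<longrightarrow> \<alpha> \<le> freq F A n}"
  have ud: "upper_density D r F A = Sup ?U" and ld: "lower_density D r F A = Sup ?L"
    by (simp_all add: upper_density_def lower_density_def freq_def)
  have ne: "D \<noteq> {}"
    and dir: "\<And>a b. a \<in> D \<Longrightarrow> b \<in> D \<Longrightarrow> \<exists>c\<in>D. (a, c) \<in> r \<and> (b, c) \<in> r"
    using D by (auto simp: directed_set_def)
  \<comment> \<open>A bound valid from \<open>a\<close> on is reached beyond any \<open>b\<close>,
    at a common upper bound of \<open>a\<close> and \<open>b\<close>.\<close>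
  have LU: "?L \<subseteq> ?U"
    using dir by blast
  have U1: "\<alpha> \<le> 1" if "\<alpha> \<in> ?U" for \<alpha>
    using frequently_le_freq_le_1[OF ne, of r \<alpha> F A] that by auto
  have bdd: "bdd_above ?U"
    using U1 by (intro bdd_aboveI[of _ 1]) auto
  have L0: "0 \<in> ?L"
    using ne by (auto simp: freq_nonneg)
  have "Sup ?L \<le> Sup ?U"
    using L0 bdd LU by (intro cSup_subset_mono) auto
  moreover have "Sup ?U \<le> 1"
    using L0 LU U1 by (intro cSup_least) auto
  ultimately have "has_density D r F A 1 \<longleftrightarrow> 1 \<le> Sup ?L"
    by (auto simp: has_density_def ud ld)
  \<comment> \<open>The supremum need not be attained, so 1 is approached from below.\<close>
  also have "\<dots> \<longleftrightarrow> (\<forall>y<1. y < Sup ?L)"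
    by (meson dense_le less_imp_le less_le_trans)
  also have "\<dots> \<longleftrightarrow> (\<forall>y<1. \<exists>\<alpha>\<in>?L. y < \<alpha>)"
    using L0 bdd_above_mono[OF bdd LU] by (subst less_cSup_iff) auto
  also have "\<dots> \<longleftrightarrow> (\<forall>y<1. \<forall>\<^sub>F n in net_filter D r. y < freq F A n)"
  proof (intro iffI allI impI)
    fix y :: real
    assume "\<forall>y<1. \<exists>\<alpha>\<in>?L. y < \<alpha>" "y < 1"
    then show "\<forall>\<^sub>F n in net_filter D r. y < freq F A n"
      unfolding eventually_net_filter[OF D] by (smt (verit) mem_Collect_eq)
  next
    fix y :: real
    assume *: "\<forall>y<1. \<forall>\<^sub>F n in net_filter D r. y < freq F A n" and "y < 1"
    \<comment> \<open>Applying the assumption at \<open>y\<close> would only put \<open>y\<close>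
      itself into \<open>?L\<close>; the intermediate \<open>z\<close> gives a member strictly above
      \<open>y\<close>.\<close>
    then obtain z where z: "y < z" "z < 1"
      using dense by blast
    have "z \<in> ?L"
      using *[rule_format, OF z(2)] unfolding eventually_net_filter[OF D]
      by (auto intro: less_imp_le)
    then show "\<exists>\<alpha>\<in>?L. y < \<alpha>"
      using z(1) by blast
  qed
  also have "\<dots> \<longleftrightarrow> (freq F A \<longlongrightarrow> 1) (net_filter D r)"
  proof -
    have "\<forall>\<^sub>F n in net_filter D r. freq F A n < z" if "1 < z" for z
      by (intro always_eventually allI) (use freq_le_1[of F A] that in \<open>auto intro: le_less_trans\<close>)
    then show ?thesis
      by (simp add: order_tendsto_iff)
  qed
  finally show ?thesis .
qed

section \<open>The least center of attraction\<close>

context G_system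
begin

definition pos_density_points ::
    "'i set \<Rightarrow> ('i \<times> 'i) set \<Rightarrow> ('i \<Rightarrow> 'g set) \<Rightarrow> 'x \<Rightarrow> 'x set" where
  "pos_density_points D r F x = {y \<in> X. \<forall>U \<subseteq> X. y \<in> mtopology interior_of U \<longrightarrow>
     upper_density D r F {g \<in> carrier G. \<phi> g x \<in> U} > 0}"

text \<open>Each \<open>F n\<close> with \<open>n\<close> in \<open>D\<close> is a finite nonempty
  subset of the group, so complementary frequencies add up to 1 there. Being a center thus becomes a
  statement about the ideal of sets with vanishing frequency.\<close>

lemma has_density_1_iff_compl:
  assumes F: "folner_net G D r F"
  shows "has_density D r F {g \<in> carrier G. P g} 1 \<longleftrightarrow>
    (freq F {g \<in> carrier G. \<not> P g} \<longlongrightarrow> 0) (net_filter D r)"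
proof -
  let ?A = "{g \<in> carrier G. P g}" and ?B = "{g \<in> carrier G. \<not> P g}"
  have D: "directed_set D r"
    using F by (simp add: folner_net_def)
  then have "D \<noteq> {}"
    by (simp add: directed_set_def)
  have B: "?B = carrier G - ?A"
    by auto
  have "freq F ?B n = 1 - freq F ?A n" if "n \<in> D" for n
    unfolding B using F that by (intro freq_Diff) (auto simp: folner_net_def)
  then have ev: "\<forall>\<^sub>F n in net_filter D r. freq F ?B n = 1 - freq F ?A n"
    using \<open>D \<noteq> {}\<close> by (auto simp: eventually_net_filter[OF D])
  have "(freq F ?A \<longlongrightarrow> 1) (net_filter D r) \<longleftrightarrow>
      ((\<lambda>n. 1 - freq F ?A n) \<longlongrightarrow> 0) (net_filter D r)"
    by (simp add: tendsto_iff dist_real_def abs_minus_commute)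
  also have "\<dots> \<longleftrightarrow> (freq F ?B \<longlongrightarrow> 0) (net_filter D r)"
    using ev by (intro tendsto_cong) (auto elim: eventually_mono)
  finally show ?thesis
    by (simp add: has_density_1_iff[OF D])
qed

text \<open>\<open>V\<close> is the interior of a neighborhood \<open>U\<close> witnessing the
  failure at \<open>y\<close>. The same \<open>U\<close> is a neighborhood of every point of
  \<open>V\<close>, so all of \<open>V\<close> avoids the set. This gives both closedness of the set
  and the open cover of the compact remainder.\<close>

lemma not_pos_density_point:
  assumes D: "directed_set D r" and "y \<in> X" "y \<notin> pos_density_points D r F x"
  obtains V where "openin mtopology V" "y \<in> V" "V \<inter> pos_density_points D r F x = {}"
    "(freq F {g \<in> carrier G. \<phi> g x \<in> V} \<longlongrightarrow> 0) (net_filter D r)"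
proof -
  obtain U where U: "U \<subseteq> X" "y \<in> mtopology interior_of U"
    "(freq F {g \<in> carrier G. \<phi> g x \<in> U} \<longlongrightarrow> 0) (net_filter D r)"
    using assms by (auto simp: pos_density_points_def upper_density_pos_iff[OF D])
  show thesis
  proof
    show "mtopology interior_of U \<inter> pos_density_points D r F x = {}"
      using U by (auto simp: pos_density_points_def upper_density_pos_iff[OF D])
    show "(freq F {g \<in> carrier G. \<phi> g x \<in> mtopology interior_of U} \<longlongrightarrow> 0) (net_filter D r)"
      by (rule freq_tendsto_0_mono[OF U(3)]) (use interior_of_subset in fastforce)
  qed (use U in auto)
qed

lemma pos_density_points_subset_center:
  assumes F: "folner_net G D r F" and C: "center_of_attraction D r F x C"
  shows "pos_density_points D r F x \<subseteq> C"
proof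
  fix y assume y: "y \<in> pos_density_points D r F x"
  have D: "directed_set D r"
    using F by (simp add: folner_net_def)
  show "y \<in> C"
  proof (rule ccontr)
    assume "y \<notin> C"
    moreover have "y \<in> X"
      using y by (simp add: pos_density_points_def)
    moreover have "openin mtopology (X - C)"
      using C by (auto simp: center_of_attraction_def closedin_def)
    ultimately obtain \<delta> where \<delta>: "\<delta> > 0" "mball y \<delta> \<subseteq> X - C"
      by (auto simp: openin_mtopology)
    \<comment> \<open>Both radii are halved so that a common point of \<open>?U\<close> and
      \<open>?N\<close> would place a point of \<open>C\<close> within \<delta> of
      \<open>y\<close>.\<close>
    let ?U = "mball y (\<delta> / 2)" and ?N = "nbhd (\<delta> / 2) C"
    have "z \<notin> ?N" if "z \<in> ?U" for z
    proof
      assume "z \<in> ?N"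
      then obtain c where c: "c \<in> C" "c \<in> X" "z \<in> X" "d c z < \<delta> / 2"
        by (auto simp: nbhd_def)
      have "d y c \<le> d y z + d c z"
        using that c triangle[of y z c] by (simp add: commute)
      then have "c \<in> mball y \<delta>"
        using that c by auto
      then show False
        using \<delta> c by auto
    qed
    then have sub: "{g \<in> carrier G. \<phi> g x \<in> ?U} \<subseteq> {g \<in> carrier G. \<phi> g x \<notin> ?N}"
      by auto
    have "has_density D r F {g \<in> carrier G. \<phi> g x \<in> ?N} 1"
      using C \<delta>(1) by (simp add: center_of_attraction_def)
    then have "(freq F {g \<in> carrier G. \<phi> g x \<in> ?U} \<longlongrightarrow> 0) (net_filter D r)"
      unfolding has_density_1_iff_compl[OF F] by (rule freq_tendsto_0_mono[OF _ sub])
    moreover have "y \<in> mtopology interior_of ?U"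
      using \<open>y \<in> X\<close> \<delta>(1) by (simp add: interior_of_openin)
    ultimately show False
      using y mball_subset_mspace unfolding pos_density_points_def upper_density_pos_iff[OF D] by blast
  qed
qed

lemma center_pos_density_points:
  assumes F: "folner_net G D r F" and x: "x \<in> X"
  shows "center_of_attraction D r F x (pos_density_points D r F x)"
  unfolding center_of_attraction_def
proof (intro conjI allI impI)
  let ?Y = "pos_density_points D r F x"
  have D: "directed_set D r"
    using F by (simp add: folner_net_def)
  have YX: "?Y \<subseteq> X"
    by (auto simp: pos_density_points_def)
  have "openin mtopology (X - ?Y)"
  proof (subst openin_subopen, intro ballI)
    fix y assume "y \<in> X - ?Y"
    then obtain V where "openin mtopology V" "y \<in> V" "V \<inter> ?Y = {}"
      using not_pos_density_point[OF D] by (metis Diff_iff)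
    then show "\<exists>T. openin mtopology T \<and> y \<in> T \<and> T \<subseteq> X - ?Y"
      using openin_subset[of mtopology V] by auto
  qed
  then show "closedin mtopology ?Y"
    using YX by (simp add: closedin_def)
  fix \<epsilon> :: real assume "\<epsilon> > 0"
  let ?K = "X - nbhd \<epsilon> ?Y"
  have "openin mtopology (nbhd \<epsilon> ?Y)"
    by (auto simp: nbhd_def)
  then have "closedin mtopology ?K"
    by (simp add: closedin_def double_diff openin_subset[of mtopology, simplified])
  then have K: "compactin mtopology ?K"
    using compact_phase_space closedin_compact_space by blast
  \<comment> \<open>Points of \<open>?K\<close> therefore lie off \<open>?Y\<close>, and each has an
    open neighborhood visited with vanishing frequency.\<close>
  have "?Y \<subseteq> nbhd \<epsilon> ?Y"
    using YX \<open>\<epsilon> > 0\<close> by (auto simp: nbhd_def)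
  then have Y: "y \<in> X" "y \<notin> ?Y" if "y \<in> ?K" for y
    using that by auto
  have "\<forall>y\<in>?K. \<exists>V. openin mtopology V \<and> y \<in> V \<and>
      (freq F {g \<in> carrier G. \<phi> g x \<in> V} \<longlongrightarrow> 0) (net_filter D r)"
    by (intro ballI, rule not_pos_density_point[OF D Y]) blast+
  then obtain V where V: "\<forall>y\<in>?K. openin mtopology (V y) \<and> y \<in> V y \<and>
      (freq F {g \<in> carrier G. \<phi> g x \<in> V y} \<longlongrightarrow> 0) (net_filter D r)"
    unfolding bchoice_iff ..
  obtain \<V> where \<V>: "finite \<V>" "\<V> \<subseteq> V ` ?K" "?K \<subseteq> \<Union>\<V>"
  proof -
    have "\<exists>\<V>. finite \<V> \<and> \<V> \<subseteq> V ` ?K \<and> ?K \<subseteq> \<Union>\<V>"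
    proof (rule compactinD[OF K])
      show "?K \<subseteq> \<Union>(V ` ?K)"
        using V by fast
    qed (use V in auto)
    then show thesis
      using that by blast
  qed
  \<comment> \<open>The orbit stays in \<open>X\<close>, so an orbit point outside the neighborhood
    of \<open>?Y\<close> lies in \<open>?K\<close> and hence in a member of the finite
    subcover.\<close>
  have "\<phi> g x \<in> X" if "g \<in> carrier G" for g
    using element_image[OF that x] by simp
  then have "{g \<in> carrier G. \<phi> g x \<notin> nbhd \<epsilon> ?Y} \<subseteq> (\<Union>W\<in>\<V>. {g \<in> carrier G. \<phi> g x \<in> W})"
    using \<V>(3) by blast
  moreover have "(freq F (\<Union>W\<in>\<V>. {g \<in> carrier G. \<phi> g x \<in> W}) \<longlongrightarrow> 0) (net_filter D r)"
    using \<V>(1,2) V by (intro freq_tendsto_0_UN) auto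
  ultimately show "has_density D r F {g \<in> carrier G. \<phi> g x \<in> nbhd \<epsilon> ?Y} 1"
    unfolding has_density_1_iff_compl[OF F] by (rule freq_tendsto_0_mono[rotated])
qed

text \<open>The set is a center contained in every center: a minimal center cannot contain it
  properly, and no proper subset of it is a center.\<close>

lemma minimal_center_iff:
  assumes "folner_net G D r F" "x \<in> X"
  shows "minimal_center_of_attraction D r F x C \<longleftrightarrow> C = pos_density_points D r F x"
  using center_pos_density_points[OF assms] pos_density_points_subset_center[OF assms(1)]
  unfolding minimal_center_of_attraction_def by blast

end

theorem lemma1p2:
  fixes G :: "('g, 'm) monoid_scheme"
    and X :: "'x set" and d :: "'x \<Rightarrow> 'x \<Rightarrow> real" and \<phi> :: "'g \<Rightarrow> 'x \<Rightarrow> 'x"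
    and D :: "'i set" and r :: "('i \<times> 'i) set" and F :: "'i \<Rightarrow> 'g set"
    and x :: 'x
  assumes "G_system G X d \<phi>"
    and "folner_net G D r F"
    and "x \<in> X"
  shows "(\<forall>C. G_system.minimal_center_of_attraction G X d \<phi> D r F x C \<longrightarrow>
            C = {y \<in> X. \<forall>U \<subseteq> X. y \<in> Metric_space.mtopology X d interior_of U \<longrightarrow>
                   upper_density D r F {g \<in> carrier G. \<phi> g x \<in> U} > 0})
       \<and> (\<exists>C. G_system.minimal_center_of_attraction G X d \<phi> D r F x C)"
proof -
  interpret G_system G X d \<phi> by fact
  show ?thesis
    \<comment> \<open>Minimality is now equality with one explicit set, so existence holds by taking
      that set.\<close>
    by (simp add: minimal_center_iff[OF assms(2,3)] pos_density_points_def)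
qed

end
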